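(* Let $\sigma$ be a balanced skew shape with height $a$ and width $b$. Let $\mu$ be any toggle-symmetric probability distribution on $\mathcal{J}(\sigma)$. Then the expected jaggedness of a subshape in $\mathcal{J}(\sigma)$ with respect to the distribution $\mu$ is $\frac{2ab}{a+b}$.
   Context: Skew shapes. For partitions $\nu\subseteq\lambda$ (i.e. $\nu_i\le\lambda_i$ for all $i$), the skew shape $\sigma=\lambda/\nu$ is the diagram obtained by removing the Young diagram of $\nu$ from that of $\lambda$ (English notation). Its height $a$ is its number of rows and its width $b$ its number of columns. Place $\sigma$ in an $a\times b$ rectangle with coordinates (row coordinate increasing downward, column coordinate increasing rightward) so that the northwest corner of the rectangle is $(0,0)$ and the southeast corner is $(a,b)$. Write $[i,j]$ for the unit box whose southeast corner is $(i,j)$. The poset $P_\sigma$ has as elements the boxes of $\sigma$, with $[i,j]\le[k,l]$ iff $i\le k$ and $j\le l$. The shape $\sigma$ is connected if $P_\sigma$ is a connected (in particular nonempty) poset. Subshapes. A subshape of $\sigma=\lambda/\nu$ is a skew shape $\rho/\nu$ with $\rho$ a partition, $\nu\subseteq\rho\subseteq\lambda$; subshapes are exactly the order ideals (down-closed subsets) of $P_\sigma$. Their set is $\mathcal{J}(\sigma)=\mathcal{J}(P_\sigma)$. Jaggedness and toggle-symmetry. For a finite poset $P$, an order ideal $I$ and $p\in P$: $p$ can be toggled in to $I$ if $p$ is a minimal element of $P\setminus I$, and $p$ can be toggled out of $I$ if $p$ is a maximal element of $I$. The jaggedness $\mathrm{jag}(I)$ is the total number of elements $p\in P$ that can be toggled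 in to $I$ or out of $I$. A probability distribution $\mu$ on $\mathcal{J}(P)$ is toggle-symmetric if for every $p\in P$, $\mathbb{P}_\mu(p\text{ can be toggled in to }I)=\mathbb{P}_\mu(p\text{ can be toggled out of }I)$. Outward corners. For connected $\sigma$, an outward corner of $\sigma$ is a pair of consecutive steps along the boundary of $\sigma$ that do not belong to the same line and do not border a common box of $\sigma$; it occurs at the lattice point $(i,j)$ where its two steps meet. Each outward corner is either a northwest corner (part of the northwest border of $\sigma$: $[i,j]\notin\sigma$ while $[i+1,j],[i,j+1]\in\sigma$) or a southeast corner (part of the southeast border: $[i+1,j+1]\notin\sigma$ while $[i+1,j],[i,j+1]\in\sigma$). $C(\sigma)$ denotes the set of outward corners. Displacement. For an outward corner $c$ occurring at $(i,j)$, $\delta(c)=1-\frac{i}{a}-\frac{j}{b}$ if $c$ is a northwest corner, and $\delta(c)=-1+\frac{i}{a}+\frac{j}{b}$ if $c$ is a southeast corner. Balanced. A skew shape $\sigma$ is balanced if it is connected and $\delta(c)=0$ for all $c\in C(\sigma)$, i.e. all outward corners occur on the main anti-diagonal, the line joining $(a,0)$ to $(0,b)$. *)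

theory Defs
  imports "HOL-Probability.Probability" "HOL-Library.Product_Order"
begin

section \<open>Skew shapes\<close>

text \<open>The value \<open>p i\<close> is the part \<open>p\<^sub>i\<^sub>+\<^sub>1\<close> of the partition, so indices start at 0;
  containment of partitions is the pointwise order on functions.\<close>

definition is_partition :: "(nat \<Rightarrow> nat) \<Rightarrow> bool" where
  "is_partition p \<longleftrightarrow> antimono p \<and> finite {i. p i \<noteq> 0}"

text \<open>The pair \<open>(i, j)\<close> stands for the unit box whose southeast corner is the lattice point
  \<open>(i, j)\<close>: row coordinate first, increasing downward. Both coordinates of a box are thus at
  least 1. Boxes are ordered componentwise, by the library's order on pairs.\<close>

type_synonym box = "nat \<times> nat"

definition young_diagram :: "(nat \<Rightarrow> nat) \<Rightarrow> box set" where
  "young_diagram p = {(Suc i, Suc j) | i j. j < p i}"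

definition skew_shape :: "(nat \<Rightarrow> nat) \<Rightarrow> (nat \<Rightarrow> nat) \<Rightarrow> box set" where
  "skew_shape la nu = young_diagram la - young_diagram nu"

definition height :: "box set \<Rightarrow> nat" where
  "height S = card (fst ` S)"

definition width :: "box set \<Rightarrow> nat" where
  "width S = card (snd ` S)"

definition subshapes :: "(nat \<Rightarrow> nat) \<Rightarrow> (nat \<Rightarrow> nat) \<Rightarrow> box set set" where
  "subshapes la nu = {skew_shape rho nu | rho. is_partition rho \<and> nu \<le> rho \<and> rho \<le> la}"


section \<open>Posets, toggling and jaggedness\<close>

definition connected_poset :: "'a::order set \<Rightarrow> bool" where
  "connected_poset P \<longleftrightarrow> P \<noteq> {} \<and>
     (\<forall>x\<in>P. \<forall>y\<in>P. (x, y) \<in> {(u, v). u \<in> P \<and> v \<in> P \<and> (u \<le> v \<or> v \<le> u)}\<^sup>*)"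

definition order_ideals :: "'a::order set \<Rightarrow> 'a set set" where
  "order_ideals P = {I. I \<subseteq> P \<and> (\<forall>x\<in>I. \<forall>y\<in>P. y \<le> x \<longrightarrow> y \<in> I)}"

definition can_toggle_in :: "'a::order set \<Rightarrow> 'a set \<Rightarrow> 'a \<Rightarrow> bool" where
  "can_toggle_in P I p \<longleftrightarrow> p \<in> P - I \<and> (\<forall>q\<in>P - I. q \<le> p \<longrightarrow> q = p)"

definition can_toggle_out :: "'a::order set \<Rightarrow> 'a set \<Rightarrow> 'a \<Rightarrow> bool" where
  "can_toggle_out P I p \<longleftrightarrow> p \<in> I \<and> (\<forall>q\<in>I. p \<le> q \<longrightarrow> q = p)"

definition jaggedness :: "'a::order set \<Rightarrow> 'a set \<Rightarrow> nat" where
  "jaggedness P I = card {p \<in> P. can_toggle_in P I p \<or> can_toggle_out P I p}"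

text \<open>Meant for distributions \<open>mu\<close> supported on the order ideals of \<open>P\<close>.\<close>

definition toggle_symmetric :: "'a::order set \<Rightarrow> 'a set pmf \<Rightarrow> bool" where
  "toggle_symmetric P mu \<longleftrightarrow>
     (\<forall>p\<in>P. measure_pmf.prob mu {I. can_toggle_in P I p} =
            measure_pmf.prob mu {I. can_toggle_out P I p})"


section \<open>Outward corners and balanced shapes\<close>

text \<open>A corner is tagged by the border it lies on and records the lattice point where it occurs.
  The four boxes around the lattice point \<open>(i, j)\<close> are \<open>(i, j)\<close>, \<open>(i, j + 1)\<close>,
  \<open>(i + 1, j)\<close> and \<open>(i + 1, j + 1)\<close>.\<close>

datatype corner = Northwest nat nat | Southeast nat nat

definition outward_corners :: "box set \<Rightarrow> corner set" where
  "outward_corners S =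
     {Northwest i j | i j. (i, j) \<notin> S \<and> (i + 1, j) \<in> S \<and> (i, j + 1) \<in> S} \<union>
     {Southeast i j | i j. (i + 1, j + 1) \<notin> S \<and> (i + 1, j) \<in> S \<and> (i, j + 1) \<in> S}"

text \<open>A skew shape, as the difference of two Young diagrams, need not touch the first row or
  column. The lattice point \<open>(north S, west S)\<close> is the northwest corner of the rectangle enclosing
  \<open>S\<close>; for a connected skew shape this rectangle has \<open>height S\<close> rows and \<open>width S\<close> columns.
  Displacements are measured relative to this point, which thereby becomes the origin.\<close>

definition north :: "box set \<Rightarrow> nat" where
  "north S = Min (fst ` S) - 1"

definition west :: "box set \<Rightarrow> nat" where
  "west S = Min (snd ` S) - 1"

fun displacement :: "box set \<Rightarrow> corner \<Rightarrow> real" where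
  "displacement S (Northwest i j) =
     1 - (real i - real (north S)) / real (height S) - (real j - real (west S)) / real (width S)"
| "displacement S (Southeast i j) =
     - 1 + (real i - real (north S)) / real (height S) + (real j - real (west S)) / real (width S)"

definition balanced :: "box set \<Rightarrow> bool" where
  "balanced S \<longleftrightarrow> connected_poset S \<and> (\<forall>c\<in>outward_corners S. displacement S c = 0)"


section \<open>Subshapes are order ideals\<close>

lemma in_young_diagram [simp]: "(Suc i, Suc j) \<in> young_diagram p \<longleftrightarrow> j < p i"
  by (auto simp: young_diagram_def)

lemma down_closed_eq_lessThan:
  fixes A :: "nat set"
  assumes "finite A" and "\<And>x y. x \<in> A \<Longrightarrow> y \<le> x \<Longrightarrow> y \<in> A"
  shows "A = {..<card A}"
proof (cases "A = {}")
  case False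
  have "A = {..Max A}"
    using assms(2)[OF Max_in[OF assms(1) False]] Max_ge[OF assms(1)] by auto
  then show ?thesis
    by (metis card_atMost lessThan_Suc_atMost)
qed simp

lemma subshapes_eq_order_ideals:
  assumes la: "is_partition la" and nu: "is_partition nu" and le: "nu \<le> la"
  shows "subshapes la nu = order_ideals (skew_shape la nu)"
proof (intro set_eqI iffI)
  fix I assume "I \<in> subshapes la nu"
  then obtain rho where rho: "is_partition rho" "nu \<le> rho" "rho \<le> la" "I = skew_shape rho nu"
    by (auto simp: subshapes_def)
  have "j' < rho i'" if "j < rho i" "i' \<le> i" "j' \<le> j" for i j i' j'
  proof -
    have "rho i \<le> rho i'"
      using rho(1) that(2) by (auto simp: is_partition_def antimono_def)
    with that show ?thesis by linarith
  qed
  moreover have "j < la i" if "j < rho i" for i j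
    using that rho(3) by (meson le_funD less_le_trans)
  ultimately show "I \<in> order_ideals (skew_shape la nu)"
    unfolding order_ideals_def rho(4) skew_shape_def young_diagram_def
    by (auto simp: less_eq_prod_def)
next
  fix I assume "I \<in> order_ideals (skew_shape la nu)"
  then have sub: "I \<subseteq> skew_shape la nu"
    and down: "\<And>x y. x \<in> I \<Longrightarrow> y \<in> skew_shape la nu \<Longrightarrow> y \<le> x \<Longrightarrow> y \<in> I"
    by (auto simp: order_ideals_def)
  define A where "A i = {j. (Suc i, Suc j) \<in> I \<or> j < nu i}" for i
  define rho where "rho i = card (A i)" for i
  have A_la: "A i \<subseteq> {..<la i}" for i
    using sub le_funD[OF le, of i] by (auto simp: A_def skew_shape_def)
  then have fin: "finite (A i)" for i
    using finite_subset by blast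
  have A_down: "j' \<in> A i'" if "j \<in> A i" "i' \<le> i" "j' \<le> j" for i j i' j'
  proof (cases "j' < nu i'")
    case False
    have "nu i \<le> nu i'" "la i \<le> la i'"
      using la nu that(2) by (auto simp: is_partition_def antimono_def)
    with False that have "(Suc i, Suc j) \<in> I" "(Suc i', Suc j') \<in> skew_shape la nu"
      using A_la[of i] by (auto simp: A_def skew_shape_def)
    then have "(Suc i', Suc j') \<in> I"
      using down that by (simp add: less_eq_prod_def)
    then show ?thesis by (simp add: A_def)
  qed (simp add: A_def)
  have A_eq: "A i = {..<rho i}" for i
    unfolding rho_def by (rule down_closed_eq_lessThan[OF fin]) (erule A_down[OF _ order_refl])
  have rho_la: "rho \<le> la"
    using A_la by (auto simp: le_fun_def A_eq)
  have "antimono rho"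
    unfolding antimono_def rho_def using A_down[OF _ _ order_refl] by (blast intro: card_mono[OF fin])
  moreover have "finite {i. rho i \<noteq> 0}"
  proof (rule finite_subset)
    show "{i. rho i \<noteq> 0} \<subseteq> {i. la i \<noteq> 0}"
      using le_funD[OF rho_la] by (metis (mono_tags, lifting) Collect_mono le_zero_eq)
    show "finite {i. la i \<noteq> 0}"
      using la by (simp add: is_partition_def)
  qed
  moreover have "nu \<le> rho"
  proof (rule le_funI)
    fix i
    have "{..<nu i} \<subseteq> A i" by (auto simp: A_def)
    then show "nu i \<le> rho i" by (simp add: A_eq)
  qed
  moreover have "I = skew_shape rho nu"
  proof -
    have iff: "j < rho i \<longleftrightarrow> (Suc i, Suc j) \<in> I \<or> j < nu i" for i j
      using A_eq[of i] by (auto simp: A_def)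
    have "(Suc i, Suc j) \<in> I \<longleftrightarrow> (Suc i, Suc j) \<in> skew_shape rho nu" for i j
      using sub by (auto simp: skew_shape_def iff)
    moreover have "\<exists>i j. x = (Suc i, Suc j)" if "x \<in> I \<or> x \<in> skew_shape rho nu" for x
      using that sub by (auto simp: skew_shape_def young_diagram_def)
    ultimately show ?thesis
      by blast
  qed
  ultimately show "I \<in> subshapes la nu"
    unfolding subshapes_def is_partition_def using rho_la by blast
qed

end

theory Submission
  imports Defs
begin

text \<open>
  Let \<open>f\<close> be the affine function on lattice points that is 1 at the northwest corner of the
  rectangle enclosing the shape and 0 at its southwest and northeast corners. A subshape \<open>I\<close> is
  cut off by a lattice path from the southwest to the northeast corner of that rectangle. The path
  turns exactly at the following points: the northwest corners of boxes that can be toggled in, the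
  southeast corners of boxes that can be toggled out, and possibly some outward corners of the
  shape. Summation by parts along the path, of the values of \<open>f\<close> at the turns taken with
  alternating signs, shows that every \<open>I\<close> satisfies
  \[ \sum_{p \text{ can be toggled in}} f(\text{NW corner of } p)
     - \sum_{p \text{ can be toggled out}} f(\text{SE corner of } p) = 1, \]
  because the outward corners and the two ends of the path contribute zeros of \<open>f\<close>: for the
  outward corners this is balancedness. This is \<open>weighted_toggles_eq_1\<close>, the heart of the proof.

  Take expectations. By toggle-symmetry a box \<open>p\<close> has the same probability \<open>t p\<close> of being
  toggled in and of being toggled out, and \<open>f\<close> drops by \<open>1/a + 1/b\<close> from the northwest to the
  southeast corner of any box. Hence \<open>(1/a + 1/b) * (\<Sum>p. t p) = 1\<close>, while the expected
  jaggedness is \<open>2 * (\<Sum>p. t p)\<close>.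

  The path is handled through its vertical steps. If \<open>rho\<close> is the sequence of row lengths of
  the subshape, row \<open>i\<close> contributes the step between the lattice points \<open>(i + 1, rho i)\<close> and
  \<open>(i, rho i)\<close>, on which \<open>f\<close> increases by \<open>1/a\<close>. Connectedness of the shape is needed to know that
  its rows form an interval and that consecutive rows overlap.
\<close>

section \<open>Boxes of skew shapes\<close>

lemma in_skew_shape:
  "(Suc i, Suc j) \<in> skew_shape la nu \<longleftrightarrow> nu i \<le> j \<and> j < la i"
  by (auto simp: skew_shape_def)

lemma skew_shape_cases:
  assumes "p \<in> skew_shape la nu"
  obtains i j where "p = (Suc i, Suc j)" "nu i \<le> j" "j < la i"
proof -
  have "\<exists>i j. p = (Suc i, Suc j) \<and> nu i \<le> j \<and> j < la i"
    using assms by (fastforce simp: skew_shape_def young_diagram_def)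
  then show thesis using that by blast
qed

lemma finite_skew_shape:
  assumes "is_partition la"
  shows "finite (skew_shape la nu)"
proof (rule finite_subset)
  show "skew_shape la nu \<subseteq> (\<Union>i\<in>{i. la i \<noteq> 0}. (\<lambda>j. (Suc i, Suc j)) ` {..<la i})"
  proof
    fix p assume "p \<in> skew_shape la nu"
    then obtain i j where "p = (Suc i, Suc j)" "j < la i" by (rule skew_shape_cases)
    then show "p \<in> (\<Union>i\<in>{i. la i \<noteq> 0}. (\<lambda>j. (Suc i, Suc j)) ` {..<la i})"
      by (intro UN_I[of i]) auto
  qed
  show "finite (\<Union>i\<in>{i. la i \<noteq> 0}. (\<lambda>j. (Suc i, Suc j)) ` {..<la i})"
    using assms by (auto simp: is_partition_def)
qed

section \<open>Connected skew shapes\<close>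

text \<open>If row \<open>k\<close> began no earlier than row \<open>k + 1\<close> ends, then all boxes in rows up to \<open>k\<close> would
  lie strictly to the northeast of all later boxes, so no box of the one kind would be comparable
  to a box of the other kind.\<close>

lemma connected_skew_shape_rows_overlap:
  assumes la: "antimono la" and nu: "antimono nu"
    and conn: "connected_poset (skew_shape la nu)"
    and i: "nu i < la i" "i \<le> k" and l: "nu l < la l" "k < l"
  shows "nu k < la (Suc k)"
proof (rule ccontr)
  assume neg: "\<not> nu k < la (Suc k)"
  let ?S = "skew_shape la nu"
  have sep: "fst q \<le> Suc k" if p: "p \<in> ?S" "fst p \<le> Suc k" and q: "q \<in> ?S" "p \<le> q \<or> q \<le> p" for p q
  proof (rule ccontr)
    assume far: "\<not> fst q \<le> Suc k"
    obtain x y where xy: "p = (Suc x, Suc y)" "nu x \<le> y" using p(1) by (rule skew_shape_cases)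
    obtain u v where uv: "q = (Suc u, Suc v)" "v < la u" using q(1) by (rule skew_shape_cases)
    have "nu k \<le> nu x" "la u \<le> la (Suc k)"
      using p(2) far xy uv by (auto intro: antimonoD[OF la] antimonoD[OF nu])
    then show False
      using neg p(2) far q(2) xy uv by auto
  qed
  \<comment> \<open>The last boxes of rows \<open>i\<close> and \<open>l\<close>, on the two sides of the cut.\<close>
  define x y where "x = (Suc i, la i)" and "y = (Suc l, la l)"
  have S: "x \<in> ?S" "y \<in> ?S"
    using i l in_skew_shape[of i "la i - 1" la nu] in_skew_shape[of l "la l - 1" la nu]
    by (auto simp: x_def y_def)
  have "(x, y) \<in> {(u, v). u \<in> ?S \<and> v \<in> ?S \<and> (u \<le> v \<or> v \<le> u)}\<^sup>*"
    using conn S unfolding connected_poset_def by blast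
  then have "y \<in> ?S \<and> fst y \<le> Suc k"
    by (induction rule: rtrancl_induct) (use S i sep in \<open>auto simp: x_def\<close>)
  then show False using l by (simp add: y_def)
qed

text \<open>Row \<open>k\<close> is nonempty iff \<open>nu k < la k\<close>, and \<open>nu k < la (k + 1)\<close> makes row \<open>k + 1\<close>
  nonempty as well, since \<open>nu\<close> decreases. So the overlap of consecutive rows also rules out gaps
  between nonempty rows.\<close>

lemma connected_skew_shape_rows:
  assumes la: "is_partition la" and nu: "is_partition nu"
    and conn: "connected_poset (skew_shape la nu)"
  obtains n m where "n \<le> m" "\<And>i. nu i < la i \<longleftrightarrow> n \<le> i \<and> i \<le> m"
    "\<And>i. n \<le> i \<Longrightarrow> i < m \<Longrightarrow> nu i < la (Suc i)"
proof -
  have anti: "antimono la" "antimono nu" using la nu by (auto simp: is_partition_def)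
  define R where "R = {i. nu i < la i}"
  have fin: "finite R"
    using la by (auto simp: R_def is_partition_def elim!: rev_finite_subset)
  have "skew_shape la nu \<noteq> {}" using conn by (simp add: connected_poset_def)
  then have ne: "R \<noteq> {}" unfolding R_def
    by (metis (mono_tags, lifting) empty_Collect_eq ex_in_conv le_less_trans skew_shape_cases)
  have in_R: "Min R \<in> R" "Max R \<in> R" using fin ne by auto
  have overlap: "nu i < la (Suc i)" if "Min R \<le> i" "i < Max R" for i
    using connected_skew_shape_rows_overlap[OF anti conn _ that(1) _ that(2)] in_R
    by (simp add: R_def)
  have "nu i < la i \<longleftrightarrow> Min R \<le> i \<and> i \<le> Max R" for i
  proof
    assume "nu i < la i"
    then show "Min R \<le> i \<and> i \<le> Max R" using fin by (simp add: R_def)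
  next
    assume i: "Min R \<le> i \<and> i \<le> Max R"
    show "nu i < la i"
    proof (cases "i = Max R")
      case True
      then show ?thesis using in_R by (simp add: R_def)
    next
      case False
      then have "nu i < la (Suc i)" using i overlap by simp
      also have "\<dots> \<le> la i" using anti by (simp add: antimonoD)
      finally show ?thesis .
    qed
  qed
  moreover have "Min R \<le> Max R" using fin in_R by simp
  ultimately show thesis using that overlap by blast
qed

text \<open>The shape starts furthest left in its last row and ends furthest right in its first row. The
  columns in between are all occupied because consecutive rows overlap: the topmost row that
  starts at or before a given column also reaches it.\<close>

lemma skew_shape_bounding_box:
  assumes la: "antimono la" and nu: "antimono nu" and nm: "n \<le> m"
    and rows: "\<And>i. nu i < la i \<longleftrightarrow> n \<le> i \<and> i \<le> m"
    and overlap: "\<And>i. n \<le> i \<Longrightarrow> i < m \<Longrightarrow> nu i < la (Suc i)"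
  shows "height (skew_shape la nu) = Suc m - n" "north (skew_shape la nu) = n"
    "width (skew_shape la nu) = la n - nu m" "west (skew_shape la nu) = nu m"
    "nu m < la n"
proof -
  let ?S = "skew_shape la nu"
  have fst: "fst ` ?S = {Suc n..Suc m}"
  proof (intro set_eqI iffI)
    fix x assume "x \<in> fst ` ?S"
    then show "x \<in> {Suc n..Suc m}" using rows by (force elim!: skew_shape_cases)
  next
    fix x assume x: "x \<in> {Suc n..Suc m}"
    then obtain i where i: "x = Suc i" by (cases x) auto
    then have "(x, Suc (nu i)) \<in> ?S" using x rows by (simp add: in_skew_shape)
    then show "x \<in> fst ` ?S" by force
  qed
  have "nu m \<le> nu n" using nu nm by (simp add: antimonoD)
  also have "\<dots> < la n" using rows nm by simp
  finally show lt: "nu m < la n" .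
  have snd: "snd ` ?S = {Suc (nu m)..la n}"
  proof (intro set_eqI iffI)
    fix y assume "y \<in> snd ` ?S"
    then obtain i j where ij: "y = Suc j" "nu i \<le> j" "j < la i" by (auto elim!: skew_shape_cases)
    then have "n \<le> i" "i \<le> m" using rows[of i] by auto
    then have "la i \<le> la n" "nu m \<le> nu i" using la nu by (auto intro: antimonoD)
    then show "y \<in> {Suc (nu m)..la n}" using ij by auto
  next
    fix y assume y: "y \<in> {Suc (nu m)..la n}"
    then obtain j where j: "y = Suc j" by (cases y) auto
    define i where "i = (LEAST i. n \<le> i \<and> nu i \<le> j)"
    have ex: "n \<le> m \<and> nu m \<le> j" using nm y j by auto
    have i: "n \<le> i" "nu i \<le> j" "i \<le> m"
      using LeastI[of "\<lambda>i. n \<le> i \<and> nu i \<le> j", OF ex] Least_le[of "\<lambda>i. n \<le> i \<and> nu i \<le> j", OF ex]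
      by (auto simp: i_def)
    have "j < la i"
    proof (cases "i = n")
      case False
      then obtain k where k: "i = Suc k" "n \<le> k" using i(1) by (cases i) auto
      have "\<not> nu k \<le> j" using not_less_Least[of k "\<lambda>i. n \<le> i \<and> nu i \<le> j"] k by (auto simp: i_def)
      then show ?thesis using overlap[of k] k i(3) by simp
    qed (use y j in auto)
    then have "(Suc i, y) \<in> ?S" using i j by (simp add: in_skew_shape)
    then show "y \<in> snd ` ?S" by force
  qed
  have Min: "Min {x..y} = x" if "x \<le> y" for x y :: nat
    using that by (intro Min_eqI) auto
  show "height ?S = Suc m - n" "north ?S = n" "width ?S = la n - nu m" "west ?S = nu m"
    using nm lt by (simp_all add: Min height_def north_def width_def west_def fst snd)
qed

section \<open>Toggling in terms of row lengths\<close>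

text \<open>The complement of the subshape is the skew shape \<open>la/rho\<close>. A minimal box of it is the first of
  its row and has no box of \<open>la/rho\<close> directly above it.\<close>

lemma can_toggle_in_iff:
  assumes la: "antimono la" and rho: "antimono rho" and le: "nu \<le> rho"
  shows "can_toggle_in (skew_shape la nu) (skew_shape rho nu) (Suc i, Suc j) \<longleftrightarrow>
    j = rho i \<and> rho i < la i \<and> (i = 0 \<or> rho i < rho (i - 1))"
proof -
  have diff: "skew_shape la nu - skew_shape rho nu = skew_shape la rho"
  proof -
    have "young_diagram nu \<subseteq> young_diagram rho"
      using le less_le_trans unfolding young_diagram_def le_fun_def by blast
    then show ?thesis by (auto simp: skew_shape_def)
  qed
  have above: "la i \<le> la (i - 1)" using la by (simp add: antimonoD)
  show ?thesis
  proof
    assume "can_toggle_in (skew_shape la nu) (skew_shape rho nu) (Suc i, Suc j)"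
    then have mem: "rho i \<le> j" "j < la i"
      and min: "\<And>q. q \<in> skew_shape la rho \<Longrightarrow> q \<le> (Suc i, Suc j) \<Longrightarrow> q = (Suc i, Suc j)"
      by (auto simp: can_toggle_in_def diff in_skew_shape)
    have j: "j = rho i"
      using min[of "(Suc i, Suc (rho i))"] mem by (simp add: in_skew_shape)
    moreover have "i = 0 \<or> rho i < rho (i - 1)"
    proof (rule ccontr)
      assume far: "\<not> (i = 0 \<or> rho i < rho (i - 1))"
      then have "(Suc (i - 1), Suc j) \<in> skew_shape la rho"
        using mem above j unfolding in_skew_shape by linarith
      then show False using min[of "(Suc (i - 1), Suc j)"] far by simp
    qed
    ultimately show "j = rho i \<and> rho i < la i \<and> (i = 0 \<or> rho i < rho (i - 1))"
      using mem by blast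
  next
    assume *: "j = rho i \<and> rho i < la i \<and> (i = 0 \<or> rho i < rho (i - 1))"
    have "q = (Suc i, Suc j)" if mem: "q \<in> skew_shape la rho" and comp: "q \<le> (Suc i, Suc j)" for q
    proof -
      obtain k l where q: "q = (Suc k, Suc l)" "rho k \<le> l" using mem by (rule skew_shape_cases)
      have "k \<le> i" "l \<le> j" using comp q by auto
      moreover have "\<not> k < i"
      proof
        assume "k < i"
        then have "rho (i - 1) \<le> rho k" using rho by (simp add: antimonoD)
        then show False using * q \<open>k < i\<close> \<open>l \<le> j\<close> by auto
      qed
      ultimately show ?thesis using q * by auto
    qed
    then show "can_toggle_in (skew_shape la nu) (skew_shape rho nu) (Suc i, Suc j)"
      unfolding can_toggle_in_def diff using * by (simp add: in_skew_shape)
  qed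
qed

lemma can_toggle_out_iff:
  assumes nu: "antimono nu" and rho: "antimono rho"
  shows "can_toggle_out (skew_shape la nu) (skew_shape rho nu) (Suc i, Suc j) \<longleftrightarrow>
    Suc j = rho i \<and> nu i < rho i \<and> rho (Suc i) < rho i"
proof
  have below: "nu (Suc i) \<le> nu i" using nu by (simp add: antimonoD)
  assume "can_toggle_out (skew_shape la nu) (skew_shape rho nu) (Suc i, Suc j)"
  then have mem: "nu i \<le> j" "j < rho i"
    and max: "\<And>q. q \<in> skew_shape rho nu \<Longrightarrow> (Suc i, Suc j) \<le> q \<Longrightarrow> q = (Suc i, Suc j)"
    by (auto simp: can_toggle_out_def in_skew_shape)
  have j: "Suc j = rho i"
  proof -
    obtain l where "rho i = Suc l" using mem by (cases "rho i") auto
    then show ?thesis using max[of "(Suc i, Suc l)"] mem by (simp add: in_skew_shape)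
  qed
  moreover have "rho (Suc i) < rho i"
  proof (rule ccontr)
    assume "\<not> rho (Suc i) < rho i"
    then have "(Suc (Suc i), Suc j) \<in> skew_shape rho nu"
      using mem below j unfolding in_skew_shape by linarith
    then show False using max[of "(Suc (Suc i), Suc j)"] by simp
  qed
  ultimately show "Suc j = rho i \<and> nu i < rho i \<and> rho (Suc i) < rho i"
    using mem by simp
next
  assume *: "Suc j = rho i \<and> nu i < rho i \<and> rho (Suc i) < rho i"
  have "q = (Suc i, Suc j)" if mem: "q \<in> skew_shape rho nu" and comp: "(Suc i, Suc j) \<le> q" for q
  proof -
    obtain k l where q: "q = (Suc k, Suc l)" "l < rho k" using mem by (rule skew_shape_cases)
    have "i \<le> k" "j \<le> l" using comp q by auto
    moreover have "\<not> i < k"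
    proof
      assume "i < k"
      then have "rho k \<le> rho (Suc i)" using rho by (simp add: antimonoD)
      then show False using * q \<open>j \<le> l\<close> by auto
    qed
    ultimately show ?thesis using q * by auto
  qed
  moreover have "(Suc i, Suc j) \<in> skew_shape rho nu"
    unfolding in_skew_shape using * by linarith
  ultimately show "can_toggle_out (skew_shape la nu) (skew_shape rho nu) (Suc i, Suc j)"
    unfolding can_toggle_out_def by blast
qed

section \<open>The weighted count of toggles\<close>

text \<open>The affine function \<open>f\<close> of the introduction. At a northwest corner of the shape it is the
  displacement, at a southeast corner the negated displacement.\<close>

definition offset :: "box set \<Rightarrow> nat \<Rightarrow> nat \<Rightarrow> real" where
  "offset S i j =
     1 - (real i - real (north S)) / real (height S) - (real j - real (west S)) / real (width S)"

lemma balanced_offset_eq_0: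
  assumes "balanced S" "(Suc i, j) \<in> S" "(i, Suc j) \<in> S" "(i, j) \<notin> S \<or> (Suc i, Suc j) \<notin> S"
  shows "offset S i j = 0"
proof -
  have "Northwest i j \<in> outward_corners S \<or> Southeast i j \<in> outward_corners S"
    using assms by (auto simp: outward_corners_def)
  then have "displacement S (Northwest i j) = 0 \<or> displacement S (Southeast i j) = 0"
    using assms(1) by (auto simp: balanced_def)
  then show ?thesis by (auto simp: offset_def)
qed

text \<open>The form of telescoping used along the path: the top end of the step in row \<open>i + 1\<close> is matched
  with the bottom end of the step in row \<open>i\<close>.\<close>

lemma sum_eq_if_shifted:
  fixes g h :: "nat \<Rightarrow> 'a::comm_monoid_add"
  assumes "n \<le> m" "g n = 0" "h m = 0" "\<And>i. n \<le> i \<Longrightarrow> i < m \<Longrightarrow> g (Suc i) = h i"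
  shows "sum g {n..m} = sum h {n..m}"
proof -
  have "sum g {n..m} = g n + sum g {Suc n..m}" using assms(1) by (rule sum.atLeast_Suc_atMost)
  also have "sum g {Suc n..m} = (\<Sum>i\<in>{n..<m}. g (Suc i))"
    unfolding atLeastLessThanSuc_atLeastAtMost[symmetric] by (rule sum.shift_bounds_Suc_ivl)
  also have "\<dots> = sum h {n..<m}" using assms(4) by (intro sum.cong) auto
  also have "g n + \<dots> = sum h {n..<m} + h m" using assms(2,3) by simp
  also have "\<dots> = sum h {n..m}"
    using assms(1) by (simp add: sum.atLeastLessThan_Suc flip: atLeastLessThanSuc_atLeastAtMost)
  finally show ?thesis .
qed

text \<open>Write \<open>F i\<close> and \<open>G i\<close> for the values of \<open>f\<close> at the top and bottom end of the vertical step in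
  row \<open>i\<close>, so that \<open>F i - G i = 1/a\<close> and the sum of these differences over the \<open>a\<close> rows is 1. The
  weights of the boxes that can be toggled are some of the \<open>F i\<close> and some of the \<open>G i\<close>; it remains to
  see that the values left out have equal sums. If rows \<open>i\<close> and \<open>i + 1\<close> have equal length, then
  neither \<open>F (i + 1)\<close> nor \<open>G i\<close> is a weight, and they are equal because the two steps meet.
  Otherwise the path turns at the ends of both steps, and where the turn does not allow a toggle it
  is an outward corner of the shape or an end of the path, where \<open>f\<close> vanishes.\<close>

lemma weighted_toggles_eq_1:
  assumes la: "is_partition la" and nu: "is_partition nu"
    and bal: "balanced (skew_shape la nu)" and I: "I \<in> subshapes la nu"
  defines "S \<equiv> skew_shape la nu"
  shows "(\<Sum>p | p \<in> S \<and> can_toggle_in S I p. offset S (fst p - 1) (snd p - 1))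
       - (\<Sum>p | p \<in> S \<and> can_toggle_out S I p. offset S (fst p) (snd p)) = 1"
proof -
  obtain rho where rho: "is_partition rho" "nu \<le> rho" "rho \<le> la" and I_eq: "I = skew_shape rho nu"
    using I by (auto simp: subshapes_def)
  have anti: "antimono la" "antimono nu" "antimono rho"
    using la nu rho(1) by (auto simp: is_partition_def)
  have between: "nu i \<le> rho i" "rho i \<le> la i" for i
    using rho(2,3) by (auto simp: le_fun_def)
  have decr: "la (Suc i) \<le> la i" "nu (Suc i) \<le> nu i" "rho (Suc i) \<le> rho i" for i
    using anti by (auto intro: antimonoD)
  have "connected_poset (skew_shape la nu)" using bal by (simp add: balanced_def)
  with la nu obtain n m where nm: "n \<le> m" and rows: "\<And>i. nu i < la i \<longleftrightarrow> n \<le> i \<and> i \<le> m"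
    and overlap: "\<And>i. n \<le> i \<Longrightarrow> i < m \<Longrightarrow> nu i < la (Suc i)"
    by (rule connected_skew_shape_rows) blast
  note box = skew_shape_bounding_box[OF anti(1,2) nm rows overlap, folded S_def]
  have bal': "offset S i j = 0"
    if "(Suc i, j) \<in> S" "(i, Suc j) \<in> S" "(i, j) \<notin> S \<or> (Suc i, Suc j) \<notin> S" for i j
    using balanced_offset_eq_0 bal that unfolding S_def by blast
  let ?in = "\<lambda>i. rho i < la i \<and> (i = 0 \<or> rho i < rho (i - 1))"
  let ?out = "\<lambda>i. nu i < rho i \<and> rho (Suc i) < rho i"
  have in_set: "{p. p \<in> S \<and> can_toggle_in S I p} = (\<lambda>i. (Suc i, Suc (rho i))) ` {i\<in>{n..m}. ?in i}"
  proof (intro set_eqI iffI)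
    fix p assume p: "p \<in> {p. p \<in> S \<and> can_toggle_in S I p}"
    then obtain i j where ij: "p = (Suc i, Suc j)" "nu i \<le> j" "j < la i"
      by (auto simp: S_def elim: skew_shape_cases)
    have "j = rho i \<and> ?in i"
      using p can_toggle_in_iff[OF anti(1,3) rho(2)] unfolding S_def I_eq ij by simp
    then show "p \<in> (\<lambda>i. (Suc i, Suc (rho i))) ` {i\<in>{n..m}. ?in i}"
      using ij rows[of i] by auto
  next
    fix p assume "p \<in> (\<lambda>i. (Suc i, Suc (rho i))) ` {i\<in>{n..m}. ?in i}"
    then show "p \<in> {p. p \<in> S \<and> can_toggle_in S I p}"
      using can_toggle_in_iff[OF anti(1,3) rho(2)] between
      by (auto simp: S_def I_eq in_skew_shape)
  qed
  have out_set: "{p. p \<in> S \<and> can_toggle_out S I p} = (\<lambda>i. (Suc i, rho i)) ` {i\<in>{n..m}. ?out i}"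
  proof (intro set_eqI iffI)
    fix p assume p: "p \<in> {p. p \<in> S \<and> can_toggle_out S I p}"
    then obtain i j where ij: "p = (Suc i, Suc j)" "nu i \<le> j" "j < la i"
      by (auto simp: S_def elim: skew_shape_cases)
    have "Suc j = rho i \<and> ?out i"
      using p can_toggle_out_iff[OF anti(2,3)] unfolding S_def I_eq ij by simp
    then show "p \<in> (\<lambda>i. (Suc i, rho i)) ` {i\<in>{n..m}. ?out i}"
      using ij rows[of i] by auto
  next
    fix p assume "p \<in> (\<lambda>i. (Suc i, rho i)) ` {i\<in>{n..m}. ?out i}"
    then obtain i where i: "p = (Suc i, rho i)" "?out i" by blast
    then obtain j where j: "rho i = Suc j" by (cases "rho i") auto
    show "p \<in> {p. p \<in> S \<and> can_toggle_out S I p}"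
      using can_toggle_out_iff[OF anti(2,3), of la i j] i j between(2)[of i]
      by (simp add: S_def I_eq in_skew_shape)
  qed
  define F G where "F i = offset S i (rho i)" and "G i = offset S (Suc i) (rho i)" for i
  have sum_in: "(\<Sum>p | p \<in> S \<and> can_toggle_in S I p. offset S (fst p - 1) (snd p - 1))
      = (\<Sum>i\<in>{n..m}. if ?in i then F i else 0)"
  proof -
    have "sum g {p. p \<in> S \<and> can_toggle_in S I p} = (\<Sum>i | i \<in> {n..m} \<and> ?in i. F i)"
      if "\<And>i. g (Suc i, Suc (rho i)) = F i" for g :: "box \<Rightarrow> real"
      unfolding in_set by (subst sum.reindex) (simp_all add: inj_on_def that)
    then show ?thesis by (simp add: F_def sum.inter_filter[symmetric])
  qed
  have sum_out: "(\<Sum>p | p \<in> S \<and> can_toggle_out S I p. offset S (fst p) (snd p))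
      = (\<Sum>i\<in>{n..m}. if ?out i then G i else 0)"
  proof -
    have "sum g {p. p \<in> S \<and> can_toggle_out S I p} = (\<Sum>i | i \<in> {n..m} \<and> ?out i. G i)"
      if "\<And>i. g (Suc i, rho i) = G i" for g :: "box \<Rightarrow> real"
      unfolding out_set by (subst sum.reindex) (simp_all add: inj_on_def that)
    then show ?thesis by (simp add: G_def sum.inter_filter[symmetric])
  qed
  have "(\<Sum>i\<in>{n..m}. if ?in i then 0 else F i) = (\<Sum>i\<in>{n..m}. if ?out i then 0 else G i)"
  proof (rule sum_eq_if_shifted[OF nm])
    \<comment> \<open>A first row that cannot be lengthened is full, so its step ends in the northeast corner.\<close>
    show "(if ?in n then 0 else F n) = 0"
    proof (cases "rho n < la n")
      case True
      \<comment> \<open>The row above the first one has no boxes, which forces \<open>rho\<close> to agree with \<open>la\<close> there.\<close>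
      have "n = 0 \<or> rho n < rho (n - 1)"
      proof (cases n)
        case (Suc k)
        then have "\<not> nu k < la k" using rows[of k] by simp
        then have "rho k = la k" using between[of k] by simp
        then show ?thesis using True decr(1)[of k] Suc by simp
      qed simp
      then show ?thesis using True by simp
    next
      case False
      then have "rho n = la n" using between(2)[of n] by simp
      then have "F n = 0" using box by (simp add: F_def offset_def)
      then show ?thesis by simp
    qed
    \<comment> \<open>A last row that cannot be shortened is empty in the subshape, so its step starts in the southwest corner.\<close>
    show "(if ?out m then 0 else G m) = 0"
    proof (cases "nu m < rho m")
      case True
      have "\<not> nu (Suc m) < la (Suc m)" using rows[of "Suc m"] by simp
      then have "rho (Suc m) < rho m"
        using True decr(2)[of m] between[of "Suc m"] by linarith
      then show ?thesis using True by simp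
    next
      case False
      then have "rho m = nu m" using between(1)[of m] by simp
      then have "G m = 0" using box nm by (simp add: G_def offset_def)
      then show ?thesis by simp
    qed
  next
    fix i assume i: "n \<le> i" "i < m"
    have ne: "nu i < la (Suc i)" "nu i < la i" "nu (Suc i) < la (Suc i)"
      using overlap rows i by auto
    show "(if ?in (Suc i) then 0 else F (Suc i)) = (if ?out i then 0 else G i)"
    proof (cases "rho (Suc i) < rho i")
      case False
      then show ?thesis using decr(3)[of i] by (simp add: F_def G_def)
    next
      case True
      \<comment> \<open>The full row \<open>i + 1\<close> ends below the interior of the longer row \<open>i\<close>: a southeast corner.\<close>
      have "F (Suc i) = 0" if "\<not> rho (Suc i) < la (Suc i)"
      proof -
        have eq: "rho (Suc i) = la (Suc i)" using that between(2)[of "Suc i"] by simp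
        obtain j where j: "la (Suc i) = Suc j" using ne by (cases "la (Suc i)") auto
        show ?thesis unfolding F_def eq
          by (rule bal')
            (use ne j True eq between(2)[of i] in \<open>auto simp: S_def in_skew_shape\<close>)
      qed
      \<comment> \<open>Row \<open>i\<close>, empty in the subshape, starts above the interior of row \<open>i + 1\<close>: a northwest corner.\<close>
      moreover have "G i = 0" if "\<not> nu i < rho i"
      proof -
        have eq: "rho i = nu i" using that between(1)[of i] by simp
        obtain j where j: "nu i = Suc j" using True eq by (cases "nu i") auto
        show ?thesis unfolding G_def eq
          by (rule bal')
            (use ne j True eq between(1)[of "Suc i"] in \<open>auto simp: S_def in_skew_shape\<close>)
      qed
      ultimately show ?thesis using True by auto
    qed
  qed
  moreover have "(\<Sum>i\<in>{n..m}. if ?in i then F i else 0) + (\<Sum>i\<in>{n..m}. if ?in i then 0 else F i)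
      = sum F {n..m}"
    unfolding sum.distrib[symmetric] by (intro sum.cong) auto
  moreover have "(\<Sum>i\<in>{n..m}. if ?out i then G i else 0) + (\<Sum>i\<in>{n..m}. if ?out i then 0 else G i)
      = sum G {n..m}"
    unfolding sum.distrib[symmetric] by (intro sum.cong) auto
  moreover have "sum F {n..m} - sum G {n..m} = 1"
  proof -
    have "F i - G i = 1 / real (height S)" for i
      by (simp add: F_def G_def offset_def flip: add_divide_distrib diff_divide_distrib)
    then have "sum F {n..m} - sum G {n..m} = (\<Sum>i\<in>{n..m}. 1 / real (height S))"
      by (simp flip: sum_subtractf)
    then show ?thesis using box(1) nm by simp
  qed
  ultimately show ?thesis unfolding sum_in sum_out by linarith
qed

section \<open>Expectations\<close>

lemma expectation_weighted_indicators:
  fixes mu :: "'b pmf" and c :: "'a \<Rightarrow> real"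
  assumes "finite P"
  shows "integrable mu (\<lambda>x. \<Sum>p | p \<in> P \<and> Q x p. c p)"
    and "measure_pmf.expectation mu (\<lambda>x. \<Sum>p | p \<in> P \<and> Q x p. c p)
       = (\<Sum>p\<in>P. c p * measure_pmf.prob mu {x. Q x p})"
proof -
  have eq: "(\<lambda>x. \<Sum>p | p \<in> P \<and> Q x p. c p) = (\<lambda>x. \<Sum>p\<in>P. c p * indicat_real {x. Q x p} x)"
    using assms by (auto simp: sum.inter_filter fun_eq_iff intro!: sum.cong)
  have int: "integrable mu (indicat_real {x. Q x p})" for p
    by (simp add: measure_pmf.emeasure_eq_measure)
  show "integrable mu (\<lambda>x. \<Sum>p | p \<in> P \<and> Q x p. c p)"
    unfolding eq using int by (intro Bochner_Integration.integrable_sum integrable_mult_right)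
  show "measure_pmf.expectation mu (\<lambda>x. \<Sum>p | p \<in> P \<and> Q x p. c p)
       = (\<Sum>p\<in>P. c p * measure_pmf.prob mu {x. Q x p})"
    unfolding eq using int by (subst Bochner_Integration.integral_sum) auto
qed

text \<open>A box that can be toggled in lies outside the ideal and one that can be toggled out lies
  inside, so no box is counted twice. The summand 1 is the constant weight for which the expectation
  of each sum is a sum of toggle probabilities.\<close>

lemma jaggedness_eq_sum:
  assumes "finite P"
  shows "real (jaggedness P I) =
    (\<Sum>p | p \<in> P \<and> can_toggle_in P I p. 1) + (\<Sum>p | p \<in> P \<and> can_toggle_out P I p. 1)"
proof -
  have "{p \<in> P. can_toggle_in P I p \<or> can_toggle_out P I p} =
      {p \<in> P. can_toggle_in P I p} \<union> {p \<in> P. can_toggle_out P I p}" by blast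
  moreover have "{p \<in> P. can_toggle_in P I p} \<inter> {p \<in> P. can_toggle_out P I p} = {}"
    by (auto simp: can_toggle_in_def can_toggle_out_def)
  ultimately show ?thesis using assms by (simp add: jaggedness_def card_Un_disjoint)
qed

theorem corollary3p8:
  fixes la nu :: "nat \<Rightarrow> nat" and a b :: nat and mu :: "box set pmf"
  assumes "is_partition la" and "is_partition nu" and "nu \<le> la"
    and "balanced (skew_shape la nu)"
    and "a = height (skew_shape la nu)" and "b = width (skew_shape la nu)"
    and "set_pmf mu \<subseteq> subshapes la nu"
    and "toggle_symmetric (skew_shape la nu) mu"
  shows "measure_pmf.expectation mu (\<lambda>I. real (jaggedness (skew_shape la nu) I))
           = 2 * real a * real b / (real a + real b)"
proof -
  define S where "S = skew_shape la nu"
  define t where "t p = measure_pmf.prob mu {I. can_toggle_in S I p}" for p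
  have fin: "finite S" unfolding S_def using assms(1) by (rule finite_skew_shape)
  have sym: "measure_pmf.prob mu {I. can_toggle_out S I p} = t p" if "p \<in> S" for p
    using assms(8) that by (simp add: toggle_symmetric_def S_def t_def)
  note expect = expectation_weighted_indicators[OF fin]
  have pos: "a > 0" "b > 0"
  proof -
    have "S \<noteq> {}" using assms(4) by (simp add: balanced_def connected_poset_def S_def)
    then show "a > 0" "b > 0"
      using fin assms(5,6) by (auto simp: height_def width_def card_gt_0_iff S_def)
  qed
  let ?w_in = "\<lambda>I. \<Sum>p | p \<in> S \<and> can_toggle_in S I p. offset S (fst p - 1) (snd p - 1)"
  let ?w_out = "\<lambda>I. \<Sum>p | p \<in> S \<and> can_toggle_out S I p. offset S (fst p) (snd p)"
  have "measure_pmf.expectation mu (\<lambda>I. ?w_in I - ?w_out I) = measure_pmf.expectation mu (\<lambda>I. 1)"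
  proof (rule integral_cong_AE)
    have "?w_in I - ?w_out I = 1" if "I \<in> set_pmf mu" for I
      unfolding S_def by (rule weighted_toggles_eq_1[OF assms(1,2,4)]) (use assms(7) that in blast)
    then show "AE I in mu. ?w_in I - ?w_out I = 1"
      unfolding AE_measure_pmf_iff by blast
  qed simp_all
  then have "1 = measure_pmf.expectation mu (\<lambda>I. ?w_in I - ?w_out I)" by simp
  also have "\<dots> = (\<Sum>p\<in>S. offset S (fst p - 1) (snd p - 1) * t p)
      - (\<Sum>p\<in>S. offset S (fst p) (snd p) * t p)"
    unfolding Bochner_Integration.integral_diff[OF expect(1) expect(1)] expect(2) t_def[symmetric]
    by (simp only: sym cong: sum.cong)
  also have "\<dots> = (\<Sum>p\<in>S. (offset S (fst p - 1) (snd p - 1) - offset S (fst p) (snd p)) * t p)"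
    unfolding left_diff_distrib by (rule sum_subtractf[symmetric])
  also have "\<dots> = (\<Sum>p\<in>S. (1 / real a + 1 / real b) * t p)"
  proof (rule sum.cong[OF refl])
    fix p assume "p \<in> S"
    then obtain i j where "p = (Suc i, Suc j)" unfolding S_def by (rule skew_shape_cases)
    then show "(offset S (fst p - 1) (snd p - 1) - offset S (fst p) (snd p)) * t p
        = (1 / real a + 1 / real b) * t p"
      using pos unfolding assms(5,6) by (simp add: offset_def S_def field_simps)
  qed
  finally have "(1 / real a + 1 / real b) * (\<Sum>p\<in>S. t p) = 1"
    by (simp add: sum_distrib_left)
  then have total: "(\<Sum>p\<in>S. t p) = real a * real b / (real a + real b)"
    using pos by (simp add: field_simps)
  have "measure_pmf.expectation mu (\<lambda>I. real (jaggedness S I)) = measure_pmf.expectation mu (\<lambda>I.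
        (\<Sum>p | p \<in> S \<and> can_toggle_in S I p. 1) + (\<Sum>p | p \<in> S \<and> can_toggle_out S I p. 1))"
    using fin by (simp only: jaggedness_eq_sum)
  also have "\<dots> = (\<Sum>p\<in>S. t p) + (\<Sum>p\<in>S. t p)"
    unfolding Bochner_Integration.integral_add[OF expect(1) expect(1)] expect(2) t_def[symmetric]
    by (simp only: sym mult_1 cong: sum.cong)
  finally show ?thesis using total by (simp add: S_def)
qed

end
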